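(* Let $\mu^y$ be the posterior measure associated with the uniform prior $\mu_0=\mu_\gamma$ and the function $\Phi$, and let $J^\delta(x):=\mu^y(B^\delta(x))$ for $x\in X$. Suppose that $\Phi:X\to\mathbb{R}$ is Lipschitz continuous on bounded sets, i.e., for every $r>0$ there exists $L=L_r>0$ such that $|\Phi(x_1)-\Phi(x_2)|\le L\|x_1-x_2\|_X$ for all $x_1,x_2\in X$ with $\|x_1\|_X,\|x_2\|_X\le r$. Let $x_1, x_2 \in E_\gamma$ and $\{w_1^\delta\}_{\delta > 0}, \{w_2^\delta\}_{\delta > 0} \subset E_\gamma$ with (i) $w_1^\delta, w_2^\delta \in E_\gamma^\delta$ for all $\delta > 0$, (ii) $w_1^\delta \to x_1$ and $w_2^\delta \to x_2$ as $\delta \to 0$. Then $$\lim_{\delta \to 0} \frac{J^\delta(w_1^\delta)}{J^\delta(w_2^\delta)} = \exp(I(x_2) - I(x_1)).$$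
   Context: $X := \{x=\{x_k\}_{k\in\mathbb{N}} \in \ell^\infty: \lim_{k\to\infty} x_k = 0\}$ (i.e. $X=c_0$), endowed with the norm $\|x\|_X=\|x\|_\infty=\sup_k|x_k|$; $e_k$ denotes the $k$-th standard unit vector and $B^\delta(x)$ the open ball of radius $\delta$ around $x$. Let $\{\gamma_k\}_{k\in\mathbb{N}}$ be non-negative reals with $\gamma_k\to0$. The prior $\mu_0=\mu_\gamma$ is the law on $X$ of $\xi := \sum_{k=1}^\infty \gamma_k \xi_k e_k$, where the $\xi_k \sim \mathcal{U}[-1,1]$ are independent and uniformly distributed on $[-1,1]$ (the series converges almost surely in $X$). $E_\gamma := \{x \in X : |x_k| \le \gamma_k \text{ for all } k \in \mathbb{N}\}$ and, for $\delta>0$, $E_\gamma^\delta := \{x \in X: |x_k| \le \max \{\gamma_k - \delta, 0\} \text{ for all } k \in \mathbb{N}\}$. For fixed data $y$ in a Banach space $Y$ and $\Phi:X\to\mathbb{R}$ (short for $\Phi(\cdot;y)$), the posterior is the probability measure $$\mu^y(A) = \frac{1}{Z(y)} \int_{A} \exp(-\Phi(x))\,\mu_0(\mathrm{d}x),\quad A\in\mathcal{B}(X),\qquad Z(y) := \int_X \exp(-\Phi(x))\,\mu_0(\mathrm{d}x),$$ where $Z(y)$ is assumed positive and finite. The functional $I:X\to\mathbb{R}\cup\{\infty\}$ is defined by $I(x):=\Phi(x)$ if $x\in E_\gamma$ and $I(x):=\infty$ otherwise. *)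

theory Defs
  imports "HOL-Probability.Probability"
begin

section \<open>The space of null sequences\<close>

typedef c0 = "{x :: nat \<Rightarrow> real. x \<longlonglongrightarrow> 0}"
  morphisms coord Abs_c0
  by (rule exI[of _ "\<lambda>_. 0"]) simp

setup_lifting type_definition_c0

lemma c0_eqI: "(\<And>k. coord x k = coord y k) \<Longrightarrow> x = y"
  by (metis coord_inject ext)

lemma coord_tendsto_0: "coord x \<longlonglongrightarrow> 0"
  using coord[of x] by simp

lemma bdd_above_coord: "bdd_above (range (\<lambda>k. \<bar>coord x k\<bar>))"
proof -
  have "Bseq (coord x)"
    using coord_tendsto_0 by (intro convergent_imp_Bseq convergentI)
  then obtain K where "\<And>k. norm (coord x k) \<le> K"
    unfolding Bseq_def by blast
  then show ?thesis
    by (auto intro!: bdd_aboveI[of _ K])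
qed

instantiation c0 :: real_normed_vector
begin

lift_definition zero_c0 :: c0 is "\<lambda>_. 0" by simp

lift_definition plus_c0 :: "c0 \<Rightarrow> c0 \<Rightarrow> c0" is "\<lambda>x y k. x k + y k"
  using tendsto_add_zero by blast

lift_definition minus_c0 :: "c0 \<Rightarrow> c0 \<Rightarrow> c0" is "\<lambda>x y k. x k - y k"
  using tendsto_diff by fastforce

lift_definition uminus_c0 :: "c0 \<Rightarrow> c0" is "\<lambda>x k. - x k"
  using tendsto_minus by fastforce

lift_definition scaleR_c0 :: "real \<Rightarrow> c0 \<Rightarrow> c0" is "\<lambda>r x k. r * x k"
  using tendsto_mult_right_zero by blast

definition norm_c0 :: "c0 \<Rightarrow> real" where
  "norm_c0 x = (SUP k. \<bar>coord x k\<bar>)"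

definition dist_c0 :: "c0 \<Rightarrow> c0 \<Rightarrow> real" where
  "dist_c0 x y = norm (x - y)"

definition sgn_c0 :: "c0 \<Rightarrow> c0" where
  "sgn_c0 x = inverse (norm x) *\<^sub>R x"

definition uniformity_c0 :: "(c0 \<times> c0) filter" where
  "uniformity_c0 = (INF e\<in>{0 <..}. principal {(x, y). dist x y < e})"

definition open_c0 :: "c0 set \<Rightarrow> bool" where
  "open_c0 U \<longleftrightarrow> (\<forall>x\<in>U. eventually (\<lambda>(x', y). x' = x \<longrightarrow> y \<in> U) uniformity)"

instance
proof
  fix x y z :: c0 and a b :: real
  note coord_simps = zero_c0.rep_eq plus_c0.rep_eq minus_c0.rep_eq uminus_c0.rep_eq scaleR_c0.rep_eq
  show "x + y + z = x + (y + z)" "x + y = y + x" "0 + x = x" "- x + x = 0" "x - y = x + - y"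
    "a *\<^sub>R (x + y) = a *\<^sub>R x + a *\<^sub>R y" "(a + b) *\<^sub>R x = a *\<^sub>R x + b *\<^sub>R x"
    "a *\<^sub>R b *\<^sub>R x = (a * b) *\<^sub>R x" "1 *\<^sub>R x = x"
    by (auto intro!: c0_eqI simp: coord_simps algebra_simps)
  show "dist x y = norm (x - y)" by (rule dist_c0_def)
  show "sgn x = inverse (norm x) *\<^sub>R x" by (rule sgn_c0_def)
  show "uniformity = (INF e\<in>{0 <..}. principal {(x, y). dist (x::c0) y < e})"
    by (rule uniformity_c0_def)
  show "open U \<longleftrightarrow> (\<forall>x\<in>U. eventually (\<lambda>(x', y). x' = x \<longrightarrow> y \<in> U) uniformity)" for U :: "c0 set"
    by (rule open_c0_def)
  have upper: "\<bar>coord u k\<bar> \<le> norm u" for u k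
    unfolding norm_c0_def by (rule cSUP_upper[OF _ bdd_above_coord]) simp
  show "norm x = 0 \<longleftrightarrow> x = 0"
  proof
    assume "norm x = 0"
    then show "x = 0"
      using upper[of x] by (auto intro!: c0_eqI simp: zero_c0.rep_eq)
  qed (simp add: norm_c0_def zero_c0.rep_eq)
  show "norm (x + y) \<le> norm x + norm y"
    unfolding norm_c0_def[of "x + y"]
  proof (rule cSUP_least)
    fix k
    show "\<bar>coord (x + y) k\<bar> \<le> norm x + norm y"
      using upper[of x k] upper[of y k] by (simp add: plus_c0.rep_eq)
  qed simp
  have scale_le: "norm (c *\<^sub>R u) \<le> \<bar>c\<bar> * norm u" for c and u :: c0
    unfolding norm_c0_def[of "c *\<^sub>R u"]
    by (rule cSUP_least) (auto simp: scaleR_c0.rep_eq abs_mult intro!: mult_left_mono upper)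
  show "norm (a *\<^sub>R x) = \<bar>a\<bar> * norm x"
  proof (cases "a = 0")
    case True
    then show ?thesis by (simp add: norm_c0_def scaleR_c0.rep_eq)
  next
    case False
    have "inverse a *\<^sub>R a *\<^sub>R x = x"
      using False by (auto intro!: c0_eqI simp: scaleR_c0.rep_eq)
    then have "norm x \<le> \<bar>inverse a\<bar> * norm (a *\<^sub>R x)"
      using scale_le[of "inverse a" "a *\<^sub>R x"] by simp
    then have "\<bar>a\<bar> * norm x \<le> norm (a *\<^sub>R x)"
      using False by (simp add: field_simps abs_inverse)
    then show ?thesis using scale_le[of a x] by simp
  qed
qed

end

lift_definition unit_vec :: "nat \<Rightarrow> c0" is "\<lambda>k i. if i = k then 1 else 0"
proof (rule tendsto_eventually)
  fix k :: nat
  show "\<forall>\<^sub>F i in sequentially. (if i = k then 1 else 0 :: real) = 0"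
    using eventually_gt_at_top[of k] by eventually_elim simp
qed


section \<open>Uniform prior, posterior and small ball probabilities\<close>

definition iid_uniform :: "'a measure \<Rightarrow> (nat \<Rightarrow> 'a \<Rightarrow> real) \<Rightarrow> bool" where
  "iid_uniform M \<xi> \<longleftrightarrow> prob_space.indep_vars M (\<lambda>_. borel) \<xi> UNIV \<and>
     (\<forall>k. distr M borel (\<xi> k) = uniform_measure lborel {-1..1})"

text \<open>The series is taken in the norm of \<^typ>\<open>c0\<close>. It converges almost surely if
  \<^term>\<open>\<gamma> \<longlonglongrightarrow> (0::real)\<close> and \<open>iid_uniform M \<xi>\<close>; on the remaining null set \<^const>\<open>suminf\<close> is
  a fixed unspecified value, which does not affect the law.\<close>
definition uniform_prior :: "'a measure \<Rightarrow> (nat \<Rightarrow> 'a \<Rightarrow> real) \<Rightarrow> (nat \<Rightarrow> real) \<Rightarrow> c0 measure" where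
  "uniform_prior M \<xi> \<gamma> = distr M borel (\<lambda>\<omega>. \<Sum>k. (\<gamma> k * \<xi> k \<omega>) *\<^sub>R unit_vec k)"

definition E :: "(nat \<Rightarrow> real) \<Rightarrow> c0 set" where
  "E \<gamma> = {x. \<forall>k. \<bar>coord x k\<bar> \<le> \<gamma> k}"

definition E_delta :: "(nat \<Rightarrow> real) \<Rightarrow> real \<Rightarrow> c0 set" where
  "E_delta \<gamma> \<delta> = {x. \<forall>k. \<bar>coord x k\<bar> \<le> max (\<gamma> k - \<delta>) 0}"

definition Z :: "c0 measure \<Rightarrow> (c0 \<Rightarrow> real) \<Rightarrow> ennreal" where
  "Z \<mu>0 \<Phi> = (\<integral>\<^sup>+ x. ennreal (exp (- \<Phi> x)) \<partial>\<mu>0)"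

definition posterior :: "c0 measure \<Rightarrow> (c0 \<Rightarrow> real) \<Rightarrow> c0 measure" where
  "posterior \<mu>0 \<Phi> = scale_measure (1 / Z \<mu>0 \<Phi>) (density \<mu>0 (\<lambda>x. ennreal (exp (- \<Phi> x))))"

definition J :: "c0 measure \<Rightarrow> (c0 \<Rightarrow> real) \<Rightarrow> real \<Rightarrow> c0 \<Rightarrow> real" where
  "J \<mu>0 \<Phi> \<delta> x = measure (posterior \<mu>0 \<Phi>) (ball x \<delta>)"

definition I :: "(nat \<Rightarrow> real) \<Rightarrow> (c0 \<Rightarrow> real) \<Rightarrow> c0 \<Rightarrow> ereal" where
  "I \<gamma> \<Phi> x = (if x \<in> E \<gamma> then ereal (\<Phi> x) else \<infinity>)"

definition lipschitz_on_bounded_sets :: "(c0 \<Rightarrow> real) \<Rightarrow> bool" where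
  "lipschitz_on_bounded_sets \<Phi> \<longleftrightarrow>
     (\<forall>r>0. \<exists>L>0. \<forall>x1 x2. norm x1 \<le> r \<longrightarrow> norm x2 \<le> r \<longrightarrow> \<bar>\<Phi> x1 - \<Phi> x2\<bar> \<le> L * norm (x1 - x2))"

end

theory Submission
  imports Defs
begin

text \<open>
  Since the points of \<^typ>\<open>c0\<close> are null sequences, the supremum
  defining the norm is attained, so an open ball is exactly the set of all \<open>x\<close> with
  \<open>\<bar>x k - w k\<bar> < \<delta>\<close> for every \<open>k\<close>. Under the prior the coordinates are independent and the
  \<open>k\<close>-th one is \<open>\<gamma> k\<close> times a uniform variable on \<open>{-1..1}\<close>. If \<open>w\<close> is in \<^term>\<open>E_delta \<gamma> \<delta>\<close>, then for
  \<open>\<gamma> k > \<delta>\<close> the interval of radius \<open>\<delta>\<close> around \<open>w k\<close> lies inside \<open>{-\<gamma> k..\<gamma> k}\<close>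
  and has probability \<open>\<delta> / \<gamma> k\<close>; for \<open>\<gamma> k \<le> \<delta>\<close> one has \<open>w k = 0\<close>, and the constraint holds
  almost surely. Hence the prior mass of the ball is the finite product of the numbers
  \<open>\<delta> / \<gamma> k\<close> over all \<open>k\<close> with \<open>\<gamma> k > \<delta>\<close>
  (\<open>measure_uniform_prior_ball\<close>): it is positive and the same for all such centres \<open>w\<close>.

  On the other hand, \<open>\<Phi>\<close> is continuous, so along shrinking balls whose centres converge to
  \<open>x\<close> the posterior mass divided by the prior mass tends to \<open>exp (- \<Phi> x)\<close> up to the
  normalisation (\<open>tendsto_measure_density_ball\<close>). In the quotient of two posterior masses,
  both the normalisation and the common prior mass cancel.

  The law of the random series only makes sense as a Borel measure once the series is known to be
  a measurable map. Separability of \<^typ>\<open>c0\<close> reduces this to measurability of the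
  coordinates (\<open>borel_measurable_c0I\<close>).
\<close>

section \<open>Norm and balls in coordinates\<close>

lemma abs_coord_le_norm: "\<bar>coord x k\<bar> \<le> norm x"
  unfolding norm_c0_def by (rule cSUP_upper[OF _ bdd_above_coord]) simp

lemma norm_c0_le: "(\<And>k. \<bar>coord x k\<bar> \<le> r) \<Longrightarrow> norm x \<le> r"
  unfolding norm_c0_def by (rule cSUP_least) auto

text \<open>All but finitely many coordinates are below \<open>r / 2\<close>, so strict coordinatewise bounds
  survive the passage to the supremum. This fails in \<open>\<ell>\<^sup>\<infinity>\<close>.\<close>

lemma norm_c0_less_iff:
  assumes "r > 0"
  shows "norm x < r \<longleftrightarrow> (\<forall>k. \<bar>coord x k\<bar> < r)"
proof
  assume "norm x < r"
  then show "\<forall>k. \<bar>coord x k\<bar> < r"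
    using abs_coord_le_norm[of x] by (meson le_less_trans)
next
  assume less: "\<forall>k. \<bar>coord x k\<bar> < r"
  obtain N where N: "\<And>k. k \<ge> N \<Longrightarrow> \<bar>coord x k\<bar> < r / 2"
    using LIMSEQ_D[OF coord_tendsto_0[of x], of "r / 2"] assms by auto
  define s where "s = Max (insert (r / 2) ((\<lambda>k. \<bar>coord x k\<bar>) ` {..<N}))"
  have "\<bar>coord x k\<bar> \<le> s" for k
  proof (cases "k < N")
    case True
    then show ?thesis unfolding s_def by (intro Max_ge) auto
  next
    case False
    have "r / 2 \<le> s" unfolding s_def by (intro Max_ge) auto
    with N[of k] False show ?thesis by simp
  qed
  then have "norm x \<le> s" by (rule norm_c0_le)
  also have "s < r" unfolding s_def using less assms by (subst Max_less_iff) auto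
  finally show "norm x < r" .
qed

lemma mem_ball_c0_iff:
  assumes "r > 0"
  shows "x \<in> ball w r \<longleftrightarrow> (\<forall>k. \<bar>coord x k - coord w k\<bar> < r)"
  using assms by (simp add: dist_commute dist_norm norm_c0_less_iff minus_c0.rep_eq abs_minus_commute)

section \<open>Separability and measurability\<close>

lift_definition rational_c0 :: "rat list \<Rightarrow> c0"
  is "\<lambda>l k. if k < length l then of_rat (l ! k) else 0"
proof (rule tendsto_eventually)
  fix l :: "rat list"
  show "\<forall>\<^sub>F k in sequentially. (if k < length l then of_rat (l ! k) else 0 :: real) = 0"
    using eventually_ge_at_top[of "length l"] by eventually_elim simp
qed

lemma rational_c0_dense:
  assumes "e > 0"
  shows "\<exists>l. dist x (rational_c0 l) < e"
proof -
  obtain N where N: "\<And>k. k \<ge> N \<Longrightarrow> \<bar>coord x k\<bar> < e"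
    using LIMSEQ_D[OF coord_tendsto_0[of x], of e] assms by auto
  have "\<exists>q. \<bar>coord x k - of_rat q\<bar> < e" for k
  proof -
    obtain q where "coord x k - e < of_rat q" "of_rat q < coord x k"
      using of_rat_dense[of "coord x k - e" "coord x k"] assms by auto
    then show ?thesis by (intro exI[of _ q]) auto
  qed
  then obtain q where q: "\<And>k. \<bar>coord x k - of_rat (q k)\<bar> < e" by metis
  have "x \<in> ball (rational_c0 (map q [0..<N])) e"
    unfolding mem_ball_c0_iff[OF assms] using q N by (auto simp: rational_c0.rep_eq)
  then show ?thesis by (auto simp: dist_commute)
qed

lemma open_c0_eq_Union_rational_balls:
  assumes "open U"
  shows "U = (\<Union>p \<in> {(l, q). ball (rational_c0 l) (of_rat q) \<subseteq> U}.
    ball (rational_c0 (fst p)) (of_rat (snd p)))"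
proof
  show "U \<subseteq> (\<Union>p \<in> {(l, q). ball (rational_c0 l) (of_rat q) \<subseteq> U}.
    ball (rational_c0 (fst p)) (of_rat (snd p)))"
  proof
    fix x assume "x \<in> U"
    then obtain e where e: "e > 0" "ball x e \<subseteq> U"
      using assms open_contains_ball by blast
    obtain q where q: "0 < (of_rat q :: real)" "of_rat q < e / 2"
      using of_rat_dense[of 0 "e / 2"] e by auto
    obtain l where l: "dist x (rational_c0 l) < of_rat q"
      using rational_c0_dense[OF q(1)] by blast
    have "ball (rational_c0 l) (of_rat q) \<subseteq> ball x e"
    proof
      fix y assume "y \<in> ball (rational_c0 l) (of_rat q)"
      then show "y \<in> ball x e"
        using l q dist_triangle[of x y "rational_c0 l"] by simp
    qed
    with e have "ball (rational_c0 l) (of_rat q) \<subseteq> U" by blast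
    with l show "x \<in> (\<Union>p \<in> {(l, q). ball (rational_c0 l) (of_rat q) \<subseteq> U}.
      ball (rational_c0 (fst p)) (of_rat (snd p)))"
      by (intro UN_I[of "(l, q)"]) (auto simp: dist_commute)
  qed
qed auto

text \<open>An open set is a countable union of balls, and a ball is a countable intersection of
  conditions on single coordinates.\<close>

lemma borel_measurable_c0I:
  fixes f :: "'a \<Rightarrow> c0"
  assumes [measurable]: "\<And>k. (\<lambda>\<omega>. coord (f \<omega>) k) \<in> borel_measurable M"
  shows "f \<in> borel_measurable M"
proof (rule borel_measurableI)
  fix U :: "c0 set" assume "open U"
  have ball: "f -` ball w r \<inter> space M \<in> sets M" for w r
  proof (cases "r > 0")
    case True
    have "f -` ball w r \<inter> space M = {\<omega> \<in> space M. \<forall>k. \<bar>coord (f \<omega>) k - coord w k\<bar> < r}"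
      using mem_ball_c0_iff[OF True] by auto
    also have "\<dots> \<in> sets M" by measurable
    finally show ?thesis .
  qed (simp add: ball_empty)
  define C where "C = {(l, q). ball (rational_c0 l) (of_rat q) \<subseteq> U}"
  have "f -` U \<inter> space M =
      (\<Union>p \<in> C. f -` ball (rational_c0 (fst p)) (of_rat (snd p)) \<inter> space M)"
    unfolding C_def by (subst open_c0_eq_Union_rational_balls[OF \<open>open U\<close>]) blast
  also have "\<dots> \<in> sets M"
    by (rule sets.countable_UN'[OF countableI_type]) (use ball in blast)
  finally show "f -` U \<inter> space M \<in> sets M" .
qed

section \<open>Unit vector series\<close>

lemma coord_sum: "coord (\<Sum>i\<in>A. f i) k = (\<Sum>i\<in>A. coord (f i) k)"
  by (induction A rule: infinite_finite_induct) (auto simp: zero_c0.rep_eq plus_c0.rep_eq)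

lemma coord_sum_unit_vec:
  "coord (\<Sum>i<n. a i *\<^sub>R unit_vec i) k = (if k < n then a k else 0)"
proof -
  have "coord (\<Sum>i<n. a i *\<^sub>R unit_vec i) k = (\<Sum>i<n. if i = k then a i else 0)"
    unfolding coord_sum by (intro sum.cong) (auto simp: scaleR_c0.rep_eq unit_vec.rep_eq)
  then show ?thesis by (simp add: sum.delta)
qed

lemma sums_unit_vec: "(\<lambda>k. coord x k *\<^sub>R unit_vec k) sums x"
  unfolding sums_def
proof (rule LIMSEQ_I)
  fix e :: real assume "e > 0"
  obtain N where N: "\<And>k. k \<ge> N \<Longrightarrow> \<bar>coord x k\<bar> < e"
    using LIMSEQ_D[OF coord_tendsto_0[of x], of e] \<open>e > 0\<close> by auto
  show "\<exists>N. \<forall>n\<ge>N. norm ((\<Sum>i<n. coord x i *\<^sub>R unit_vec i) - x) < e"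
    using N \<open>e > 0\<close>
    by (intro exI[of _ N]) (auto simp: norm_c0_less_iff minus_c0.rep_eq coord_sum_unit_vec)
qed

lemma suminf_unit_vec:
  assumes "a \<longlonglongrightarrow> 0"
  shows "coord (\<Sum>k. a k *\<^sub>R unit_vec k) = a"
proof -
  have "coord (Abs_c0 a) = a" using assms by (simp add: Abs_c0_inverse)
  then show ?thesis using sums_unique[OF sums_unit_vec[of "Abs_c0 a"]] by simp
qed

lemma summable_unit_vec_imp_tendsto_0:
  assumes "summable (\<lambda>k. a k *\<^sub>R unit_vec k)"
  shows "a \<longlonglongrightarrow> 0"
proof -
  have "(\<lambda>k. a k *\<^sub>R unit_vec k) \<longlonglongrightarrow> 0" by (rule summable_LIMSEQ_zero[OF assms])
  then have "(\<lambda>k. norm (a k *\<^sub>R unit_vec k)) \<longlonglongrightarrow> 0" by (rule tendsto_norm_zero)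
  moreover have "\<bar>a k\<bar> \<le> norm (a k *\<^sub>R unit_vec k)" for k
    using abs_coord_le_norm[of "a k *\<^sub>R unit_vec k" k] by (simp add: scaleR_c0.rep_eq unit_vec.rep_eq)
  ultimately show ?thesis
    by (intro tendsto_0_le[where K = 1, of _ sequentially a]) auto
qed

text \<open>Where the coefficients tend to \<open>0\<close>, they are the coordinates of the limit. Off the
  measurable set where this happens, no series is summable, so \<^const>\<open>suminf\<close> takes one and the same value there and cannot spoil measurability.\<close>

lemma borel_measurable_suminf_unit_vec:
  fixes a :: "nat \<Rightarrow> 'a \<Rightarrow> real"
  assumes [measurable]: "\<And>k. a k \<in> borel_measurable M"
  shows "(\<lambda>\<omega>. \<Sum>k. a k \<omega> *\<^sub>R unit_vec k) \<in> borel_measurable M"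
proof (rule borel_measurable_c0I)
  fix k
  define z :: c0 where "z = (THE s. False)"
  have not_summable: "(\<Sum>k. a k \<omega> *\<^sub>R unit_vec k) = z" if "\<not> (\<lambda>k. a k \<omega>) \<longlonglongrightarrow> 0" for \<omega>
  proof -
    have "\<not> (\<lambda>k. a k \<omega> *\<^sub>R unit_vec k) sums s" for s
      using that summable_unit_vec_imp_tendsto_0[OF sums_summable] by auto
    then show ?thesis by (simp add: suminf_def z_def)
  qed
  have "(\<lambda>\<omega>. coord (\<Sum>k. a k \<omega> *\<^sub>R unit_vec k) k) =
      (\<lambda>\<omega>. if (\<lambda>k. a k \<omega>) \<longlonglongrightarrow> 0 then a k \<omega> else coord z k)"
    by (auto simp: not_summable suminf_unit_vec)
  also have "\<dots> \<in> borel_measurable M" by measurable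
  finally show "(\<lambda>\<omega>. coord (\<Sum>k. a k \<omega> *\<^sub>R unit_vec k) k) \<in> borel_measurable M" .
qed

section \<open>Prior mass of small balls\<close>

lemma iid_uniform_measurable:
  assumes "prob_space M" "iid_uniform M \<xi>"
  shows "\<xi> k \<in> borel_measurable M"
  using assms unfolding iid_uniform_def by (auto simp: prob_space.indep_vars_def)

lemma distr_iid_uniform:
  "iid_uniform M \<xi> \<Longrightarrow> distr M borel (\<xi> k) = uniform_measure lborel {-1..1}"
  by (simp add: iid_uniform_def)

lemma AE_iid_uniform:
  assumes "prob_space M" "iid_uniform M \<xi>"
  shows "AE \<omega> in M. \<forall>k. \<bar>\<xi> k \<omega>\<bar> < 1"
proof (subst AE_all_countable, rule allI)
  fix k
  have "AE x in uniform_measure lborel {-1..1::real}. \<bar>x\<bar> < 1"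
    using AE_lborel_singleton[of "1::real"] AE_lborel_singleton[of "-1::real"]
    by (intro AE_uniform_measureI) (auto elim!: eventually_elim2)
  then have "AE x in distr M borel (\<xi> k). \<bar>x\<bar> < 1"
    by (simp only: distr_iid_uniform[OF assms(2)])
  then show "AE \<omega> in M. \<bar>\<xi> k \<omega>\<bar> < 1"
    by (rule AE_distrD[OF iid_uniform_measurable[OF assms]])
qed

lemma measure_scaled_uniform_interval:
  assumes "prob_space M" "iid_uniform M \<xi>"
    and "0 < \<delta>" "0 < c" "\<bar>w\<bar> \<le> c - \<delta>"
  shows "measure M (\<xi> k -` {(w - \<delta>) / c <..< (w + \<delta>) / c} \<inter> space M) = \<delta> / c"
proof -
  have sub: "{-1..1} \<inter> {(w - \<delta>) / c <..< (w + \<delta>) / c} = {(w - \<delta>) / c <..< (w + \<delta>) / c}"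
  proof -
    have "-1 \<le> (w - \<delta>) / c" "(w + \<delta>) / c \<le> 1" using assms by (auto simp: field_simps)
    then show ?thesis by auto
  qed
  have le: "(w - \<delta>) / c \<le> (w + \<delta>) / c" using assms by (intro divide_right_mono) auto
  have "measure M (\<xi> k -` {(w - \<delta>) / c <..< (w + \<delta>) / c} \<inter> space M)
      = measure (distr M borel (\<xi> k)) {(w - \<delta>) / c <..< (w + \<delta>) / c}"
    by (rule measure_distr[symmetric]) (auto intro: iid_uniform_measurable assms)
  also have "distr M borel (\<xi> k) = uniform_measure lborel {-1..1}"
    by (rule distr_iid_uniform[OF assms(2)])
  also have "measure (uniform_measure lborel {-1..1}) {(w - \<delta>) / c <..< (w + \<delta>) / c}
      = measure lborel {(w - \<delta>) / c <..< (w + \<delta>) / c} / 2"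
    by (subst measure_uniform_measure) (auto simp: sub)
  also have "\<dots> = \<delta> / c" using le assms by (simp add: field_simps)
  finally show ?thesis .
qed

lemma uniform_series_measurable:
  assumes "prob_space M" "iid_uniform M \<xi>"
  shows "(\<lambda>\<omega>. \<Sum>k. (\<gamma> k * \<xi> k \<omega>) *\<^sub>R unit_vec k) \<in> borel_measurable M"
  using iid_uniform_measurable[OF assms, measurable]
  by (intro borel_measurable_suminf_unit_vec) measurable

lemma prob_space_uniform_prior:
  assumes "prob_space M" "iid_uniform M \<xi>"
  shows "prob_space (uniform_prior M \<xi> \<gamma>)"
  unfolding uniform_prior_def
  by (intro prob_space.prob_space_distr[OF assms(1)] uniform_series_measurable[OF assms])

text \<open>The right-hand side does not mention the centre \<open>w\<close>. Only the finitely many coordinates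
  with \<open>\<gamma> k > \<delta>\<close> impose a constraint of probability less than one, which turns the event into a
  finite intersection to which independence applies.\<close>

lemma measure_uniform_prior_ball:
  assumes M: "prob_space M" "iid_uniform M \<xi>"
    and \<gamma>: "\<And>k. \<gamma> k \<ge> 0" "\<gamma> \<longlonglongrightarrow> 0"
    and "\<delta> > 0" and w: "w \<in> E_delta \<gamma> \<delta>"
  shows "measure (uniform_prior M \<xi> \<gamma>) (ball w \<delta>) = (\<Prod>k | \<gamma> k > \<delta>. \<delta> / \<gamma> k)"
proof -
  interpret prob_space M by (rule M)
  note [measurable] = iid_uniform_measurable[OF M]
  define F where "F = {k. \<gamma> k > \<delta>}"
  define S where "S \<omega> = (\<Sum>k. (\<gamma> k * \<xi> k \<omega>) *\<^sub>R unit_vec k)" for \<omega>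
  define A where "A k = {(coord w k - \<delta>) / \<gamma> k <..< (coord w k + \<delta>) / \<gamma> k}" for k
  have S[measurable]: "S \<in> borel_measurable M"
    unfolding S_def by (rule uniform_series_measurable[OF M])
  have finF: "finite F"
  proof -
    obtain N where N: "\<And>k. k \<ge> N \<Longrightarrow> \<bar>\<gamma> k\<bar> < \<delta>"
      using LIMSEQ_D[OF \<gamma>(2) \<open>\<delta> > 0\<close>] by auto
    have "F \<subseteq> {..<N}"
    proof
      fix k assume "k \<in> F"
      then show "k \<in> {..<N}" using N[of k] by (cases "N \<le> k") (auto simp: F_def)
    qed
    then show ?thesis using finite_subset by blast
  qed
  have ae: "AE \<omega> in M. S \<omega> \<in> ball w \<delta> \<longleftrightarrow> (\<forall>k\<in>F. \<xi> k \<omega> \<in> A k)"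
    using AE_iid_uniform[OF M]
  proof eventually_elim
    case (elim \<omega>)
    have "(\<lambda>k. \<gamma> k * \<xi> k \<omega>) \<longlonglongrightarrow> 0"
    proof (rule tendsto_0_le[OF \<gamma>(2), where K = 1])
      show "\<forall>\<^sub>F k in sequentially. norm (\<gamma> k * \<xi> k \<omega>) \<le> norm (\<gamma> k) * 1"
      proof (intro always_eventually allI)
        fix k
        have "\<bar>\<gamma> k\<bar> * \<bar>\<xi> k \<omega>\<bar> \<le> \<bar>\<gamma> k\<bar> * 1"
          using elim by (intro mult_left_mono) (auto intro: less_imp_le)
        then show "norm (\<gamma> k * \<xi> k \<omega>) \<le> norm (\<gamma> k) * 1" by (simp add: abs_mult)
      qed
    qed
    then have coord: "coord (S \<omega>) k = \<gamma> k * \<xi> k \<omega>" for k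
      unfolding S_def by (simp add: suminf_unit_vec)
    have "\<bar>\<gamma> k * \<xi> k \<omega> - coord w k\<bar> < \<delta> \<longleftrightarrow> (k \<in> F \<longrightarrow> \<xi> k \<omega> \<in> A k)" for k
    proof (cases "k \<in> F")
      case True
      then have "\<gamma> k > 0" using \<open>\<delta> > 0\<close> by (simp add: F_def)
      then show ?thesis using True by (auto simp: A_def field_simps abs_less_iff)
    next
      case False
      then have le: "\<gamma> k \<le> \<delta>" by (simp add: F_def)
      \<comment> \<open>Here the constraint holds anyway: the centre is \<open>0\<close>, and \<open>\<bar>\<xi> k \<omega>\<bar> < 1\<close> is strict, which
        settles the boundary case \<open>\<gamma> k = \<delta>\<close>.\<close>
      then have "coord w k = 0" using w by (auto simp: E_delta_def max_def dest!: spec[of _ k])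
      moreover have "\<gamma> k * \<bar>\<xi> k \<omega>\<bar> < \<delta>"
      proof (cases "\<gamma> k = 0")
        case False
        then have "\<gamma> k * \<bar>\<xi> k \<omega>\<bar> < \<gamma> k * 1"
          using \<gamma>(1)[of k] elim by (intro mult_strict_left_mono) auto
        with le show ?thesis by simp
      qed (use \<open>\<delta> > 0\<close> in simp)
      ultimately show ?thesis using False \<gamma>(1)[of k] by (simp add: abs_mult)
    qed
    then show ?case unfolding mem_ball_c0_iff[OF \<open>\<delta> > 0\<close>] coord by blast
  qed
  have A[measurable]: "A k \<in> sets borel" for k unfolding A_def by simp
  have "measure (uniform_prior M \<xi> \<gamma>) (ball w \<delta>) = prob (S -` ball w \<delta> \<inter> space M)"
    unfolding uniform_prior_def S_def[symmetric] by (rule measure_distr) auto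
  also have "\<dots> = prob {\<omega> \<in> space M. \<forall>k\<in>F. \<xi> k \<omega> \<in> A k}"
  proof (rule measure_eq_AE)
    show "S -` ball w \<delta> \<inter> space M \<in> sets M" by (rule measurable_sets[OF S]) simp
    show "{\<omega> \<in> space M. \<forall>k\<in>F. \<xi> k \<omega> \<in> A k} \<in> sets M" using finF by measurable
    show "AE \<omega> in M. \<omega> \<in> S -` ball w \<delta> \<inter> space M \<longleftrightarrow> \<omega> \<in> {\<omega> \<in> space M. \<forall>k\<in>F. \<xi> k \<omega> \<in> A k}"
      using ae by eventually_elim auto
  qed
  also have "\<dots> = (\<Prod>k\<in>F. prob (\<xi> k -` A k \<inter> space M))"
  proof (cases "F = {}")
    case True
    then show ?thesis by (simp add: prob_space)
  next
    case False
    have "{\<omega> \<in> space M. \<forall>k\<in>F. \<xi> k \<omega> \<in> A k} = (\<Inter>k\<in>F. \<xi> k -` A k \<inter> space M)"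
      using False by auto
    also have "prob \<dots> = (\<Prod>k\<in>F. prob (\<xi> k -` A k \<inter> space M))"
      using M(2) False finF A unfolding iid_uniform_def
      by (intro indep_varsD[where M' = "\<lambda>_. borel" and I = UNIV]) auto
    finally show ?thesis .
  qed
  also have "\<dots> = (\<Prod>k\<in>F. \<delta> / \<gamma> k)"
  proof (rule prod.cong[OF refl])
    fix k assume "k \<in> F"
    then have "\<gamma> k > \<delta>" by (simp add: F_def)
    moreover from this have "\<bar>coord w k\<bar> \<le> \<gamma> k - \<delta>"
      using w by (auto simp: E_delta_def max_def dest!: spec[of _ k])
    ultimately show "prob (\<xi> k -` A k \<inter> space M) = \<delta> / \<gamma> k"
      unfolding A_def using \<open>\<delta> > 0\<close> by (intro measure_scaled_uniform_interval[OF M]) auto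
  qed
  finally show ?thesis by (simp add: F_def)
qed

section \<open>Posterior mass of small balls\<close>

text \<open>Averages of a function over shrinking balls that close in on a point of continuity tend to
  the value at that point, for any finite measure that charges the balls, because the function
  is uniformly close to that value on them.\<close>

lemma tendsto_measure_density_ball:
  fixes g :: "'b :: metric_space \<Rightarrow> real" and w :: "real \<Rightarrow> 'b"
  assumes \<mu>: "finite_measure \<mu>" "sets \<mu> = sets borel"
    and g: "g \<in> borel_measurable \<mu>" "\<And>y. g y \<ge> 0" "isCont g x"
    and w: "(w \<longlongrightarrow> x) (at_right 0)"
    and pos: "\<And>\<delta>. \<delta> > 0 \<Longrightarrow> measure \<mu> (ball (w \<delta>) \<delta>) > 0"
  shows "((\<lambda>\<delta>. measure (density \<mu> g) (ball (w \<delta>) \<delta>) / measure \<mu> (ball (w \<delta>) \<delta>))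
    \<longlongrightarrow> g x) (at_right 0)"
proof (rule tendstoI)
  interpret finite_measure \<mu> by (rule \<mu>)
  note [measurable] = g(1)
  fix e :: real assume "e > 0"
  define h where "h = e / 2"
  have "h > 0" using \<open>e > 0\<close> by (simp add: h_def)
  then obtain d where d: "d > 0" "\<And>y. dist y x < d \<Longrightarrow> \<bar>g y - g x\<bar> < h"
    using g(3) unfolding continuous_at_eps_delta dist_real_def by metis
  have small: "\<forall>\<^sub>F \<delta> in at_right 0. \<delta> < d / 2"
    by (rule order_tendstoD(2)[OF tendsto_ident_at]) (use d(1) in simp)
  have near: "\<forall>\<^sub>F \<delta> in at_right 0. dist (w \<delta>) x < d / 2"
    using d(1) by (intro tendstoD[OF w]) simp
  show "\<forall>\<^sub>F \<delta> in at_right 0.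
    dist (measure (density \<mu> g) (ball (w \<delta>) \<delta>) / measure \<mu> (ball (w \<delta>) \<delta>)) (g x) < e"
    using small near eventually_at_right_less[of 0]
  proof eventually_elim
    case (elim \<delta>)
    define B where "B = ball (w \<delta>) \<delta>"
    have B[measurable]: "B \<in> sets \<mu>" by (simp add: B_def \<mu>)
    define c where "c = measure \<mu> B"
    have c: "c > 0" "emeasure \<mu> B = ennreal c"
      using pos[OF elim(3)] by (auto simp: c_def B_def emeasure_eq_measure)
    have on_B: "\<bar>g y - g x\<bar> < h" if "y \<in> B" for y
    proof (rule d(2))
      show "dist y x < d"
        using that elim dist_triangle[of y x "w \<delta>"] by (simp add: B_def dist_commute)
    qed
    have D: "emeasure (density \<mu> g) B = (\<integral>\<^sup>+y. ennreal (g y) * indicator B y \<partial>\<mu>)"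
      by (rule emeasure_density) measurable
    have "(\<integral>\<^sup>+y. ennreal (g y) * indicator B y \<partial>\<mu>)
        \<le> (\<integral>\<^sup>+y. ennreal (g x + h) * indicator B y \<partial>\<mu>)"
      using on_B by (intro nn_integral_mono) (fastforce split: split_indicator intro!: ennreal_leI)
    also have "\<dots> = ennreal ((g x + h) * c)"
      using c g(2)[of x] \<open>h > 0\<close> by (simp add: nn_integral_cmult_indicator ennreal_mult)
    finally have upper: "emeasure (density \<mu> g) B \<le> ennreal ((g x + h) * c)" by (simp add: D)
    have "ennreal ((g x - h) * c) = ennreal (g x - h) * ennreal c"
      using c by (simp add: ennreal_mult'')
    also have "\<dots> = (\<integral>\<^sup>+y. ennreal (g x - h) * indicator B y \<partial>\<mu>)"
      using c by (simp add: nn_integral_cmult_indicator)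
    also have "\<dots> \<le> (\<integral>\<^sup>+y. ennreal (g y) * indicator B y \<partial>\<mu>)"
      using on_B by (intro nn_integral_mono) (fastforce split: split_indicator intro!: ennreal_leI)
    finally have lower: "ennreal ((g x - h) * c) \<le> emeasure (density \<mu> g) B" by (simp add: D)
    have fin: "emeasure (density \<mu> g) B = ennreal (measure (density \<mu> g) B)"
      using upper by (intro emeasure_eq_ennreal_measure) (auto simp: top_unique)
    have "measure (density \<mu> g) B \<le> (g x + h) * c"
      using upper c g(2)[of x] \<open>h > 0\<close> unfolding fin by (simp add: ennreal_le_iff)
    moreover have "(g x - h) * c \<le> measure (density \<mu> g) B"
      using lower unfolding fin by (simp add: ennreal_le_iff)
    ultimately have "\<bar>measure (density \<mu> g) B / c - g x\<bar> \<le> h"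
      using c(1) by (auto simp: abs_le_iff field_simps)
    then show ?case using \<open>e > 0\<close> by (simp add: dist_real_def h_def c_def B_def)
  qed
qed

lemma lipschitz_on_bounded_sets_isCont:
  assumes "lipschitz_on_bounded_sets \<Phi>"
  shows "isCont \<Phi> x"
proof -
  have "norm x + 1 > 0" by (simp add: add_nonneg_pos)
  then obtain L where L: "\<And>y z. norm y \<le> norm x + 1 \<Longrightarrow> norm z \<le> norm x + 1 \<Longrightarrow>
      \<bar>\<Phi> y - \<Phi> z\<bar> \<le> L * norm (y - z)"
    using assms unfolding lipschitz_on_bounded_sets_def by metis
  have "\<forall>\<^sub>F y in at x. dist y x < 1"
    by (auto simp: eventually_at intro!: exI[of _ 1])
  then have "\<forall>\<^sub>F y in at x. norm (\<Phi> y - \<Phi> x) \<le> L * norm (y - x)"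
  proof eventually_elim
    case (elim y)
    then have "norm y \<le> norm x + 1"
      using norm_triangle_ineq2[of y x] by (simp add: dist_norm)
    then show ?case using L[of y x] by simp
  qed
  moreover have "((\<lambda>y. L * norm (y - x)) \<longlongrightarrow> 0) (at x)"
    by (rule tendsto_eq_intros refl | simp)+
  ultimately have "((\<lambda>y. \<Phi> y - \<Phi> x) \<longlongrightarrow> 0) (at x)"
    by (rule Lim_null_comparison)
  then show ?thesis by (simp add: isCont_def LIM_zero_iff)
qed

lemma J_eq:
  "J \<mu>0 \<Phi> \<delta> x =
    enn2real (1 / Z \<mu>0 \<Phi>) * measure (density \<mu>0 (\<lambda>x. exp (- \<Phi> x))) (ball x \<delta>)"
  by (simp add: J_def posterior_def measure_def enn2real_mult)

theorem proposition5p8: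
  fixes M :: "'a measure" and \<xi> :: "nat \<Rightarrow> 'a \<Rightarrow> real" and \<gamma> :: "nat \<Rightarrow> real"
    and \<mu>0 :: "c0 measure" and \<Phi> :: "c0 \<Rightarrow> real"
    and x1 x2 :: c0 and w1 w2 :: "real \<Rightarrow> c0"
  assumes "prob_space M" and "iid_uniform M \<xi>"
    and "\<And>k. \<gamma> k \<ge> 0" and "\<gamma> \<longlonglongrightarrow> 0"
    and "\<mu>0 = uniform_prior M \<xi> \<gamma>"
    and "0 < Z \<mu>0 \<Phi>" and "Z \<mu>0 \<Phi> < \<infinity>"
    and "lipschitz_on_bounded_sets \<Phi>"
    and "x1 \<in> E \<gamma>" and "x2 \<in> E \<gamma>"
    and "\<And>\<delta>. \<delta> > 0 \<Longrightarrow> w1 \<delta> \<in> E \<gamma>" and "\<And>\<delta>. \<delta> > 0 \<Longrightarrow> w2 \<delta> \<in> E \<gamma>"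
    and "\<And>\<delta>. \<delta> > 0 \<Longrightarrow> w1 \<delta> \<in> E_delta \<gamma> \<delta>" and "\<And>\<delta>. \<delta> > 0 \<Longrightarrow> w2 \<delta> \<in> E_delta \<gamma> \<delta>"
    and "(w1 \<longlongrightarrow> x1) (at_right 0)" and "(w2 \<longlongrightarrow> x2) (at_right 0)"
  shows "((\<lambda>\<delta>. J \<mu>0 \<Phi> \<delta> (w1 \<delta>) / J \<mu>0 \<Phi> \<delta> (w2 \<delta>))
           \<longlongrightarrow> exp (real_of_ereal (I \<gamma> \<Phi> x2 - I \<gamma> \<Phi> x1))) (at_right 0)"
proof -
  interpret \<mu>: prob_space \<mu>0 unfolding assms(5) by (rule prob_space_uniform_prior[OF assms(1,2)])
  have sets: "sets \<mu>0 = sets borel" by (simp add: assms(5) uniform_prior_def)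
  have cont: "isCont (\<lambda>x. exp (- \<Phi> x)) x" for x
    by (intro continuous_intros lipschitz_on_bounded_sets_isCont assms)
  have meas: "(\<lambda>x. exp (- \<Phi> x)) \<in> borel_measurable \<mu>0"
    unfolding measurable_cong_sets[OF sets refl]
    by (intro borel_measurable_continuous_onI continuous_at_imp_continuous_on ballI cont)
  define c where "c \<delta> = (\<Prod>k | \<gamma> k > \<delta>. \<delta> / \<gamma> k)" for \<delta>
  define D where "D \<delta> x = measure (density \<mu>0 (\<lambda>x. exp (- \<Phi> x))) (ball x \<delta>)" for \<delta> x
  have c_pos: "c \<delta> > 0" if "\<delta> > 0" for \<delta>
    unfolding c_def using that by (intro prod_pos) auto
  have lim: "((\<lambda>\<delta>. D \<delta> (w \<delta>) / c \<delta>) \<longlongrightarrow> exp (- \<Phi> x)) (at_right 0)"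
    if w: "\<And>\<delta>. \<delta> > 0 \<Longrightarrow> w \<delta> \<in> E_delta \<gamma> \<delta>" "(w \<longlongrightarrow> x) (at_right 0)" for w x
  proof -
    have ball: "measure \<mu>0 (ball (w \<delta>) \<delta>) = c \<delta>" if "\<delta> > 0" for \<delta>
      unfolding c_def assms(5)
      by (rule measure_uniform_prior_ball[OF assms(1,2,3,4) that w(1)[OF that]])
    have "((\<lambda>\<delta>. D \<delta> (w \<delta>) / measure \<mu>0 (ball (w \<delta>) \<delta>)) \<longlongrightarrow> exp (- \<Phi> x)) (at_right 0)"
      unfolding D_def
      by (rule tendsto_measure_density_ball[OF \<mu>.finite_measure_axioms sets meas _ cont w(2)])
        (auto simp: ball c_pos)
    moreover have "\<forall>\<^sub>F \<delta> in at_right 0.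
        D \<delta> (w \<delta>) / measure \<mu>0 (ball (w \<delta>) \<delta>) = D \<delta> (w \<delta>) / c \<delta>"
      using eventually_at_right_less[of 0] by eventually_elim (simp add: ball)
    ultimately show ?thesis by (rule Lim_transform_eventually)
  qed
  have "1 / Z \<mu>0 \<Phi> > 0" "1 / Z \<mu>0 \<Phi> < \<infinity>"
    using assms(6,7) by (auto simp: ennreal_zero_less_divide less_top[symmetric] ennreal_divide_eq_top_iff)
  then have norm_pos: "enn2real (1 / Z \<mu>0 \<Phi>) > 0" by (simp add: enn2real_positive_iff)
  have "((\<lambda>\<delta>. (D \<delta> (w1 \<delta>) / c \<delta>) / (D \<delta> (w2 \<delta>) / c \<delta>)) \<longlongrightarrow> exp (- \<Phi> x1) / exp (- \<Phi> x2))
      (at_right 0)"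
    by (intro tendsto_divide lim assms) simp_all
  moreover have "\<forall>\<^sub>F \<delta> in at_right 0. (D \<delta> (w1 \<delta>) / c \<delta>) / (D \<delta> (w2 \<delta>) / c \<delta>) =
      J \<mu>0 \<Phi> \<delta> (w1 \<delta>) / J \<mu>0 \<Phi> \<delta> (w2 \<delta>)"
    using eventually_at_right_less[of 0]
  proof eventually_elim
    case (elim \<delta>)
    then show ?case using c_pos[of \<delta>] norm_pos by (simp add: J_eq D_def)
  qed
  ultimately have "((\<lambda>\<delta>. J \<mu>0 \<Phi> \<delta> (w1 \<delta>) / J \<mu>0 \<Phi> \<delta> (w2 \<delta>))
      \<longlongrightarrow> exp (- \<Phi> x1) / exp (- \<Phi> x2)) (at_right 0)"
    by (rule Lim_transform_eventually)
  moreover have "exp (- \<Phi> x1) / exp (- \<Phi> x2) = exp (real_of_ereal (I \<gamma> \<Phi> x2 - I \<gamma> \<Phi> x1))"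
    using assms(9,10) by (simp add: I_def exp_diff[symmetric])
  ultimately show ?thesis by simp
qed

end
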